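(* The conjunction of disjunctions problem is $(m+1+3(l-1))$-split-neighborly. That is: let $d,m,l\ge1$ with $d\ge lm$, let $\mathcal{X}=\{0,1\}^d$, and let $\mathcal{H}$ be the set of all conjunctions of $l$ disjunctions over $d$ variables without negations, where each disjunction has exactly $m$ variables and no variable appears in more than one disjunction. Then $(\mathcal{H},\mathcal{X})$ is $(m+1+3(l-1))$-split-neighborly.
   Context: A hypothesis is a function $h:\{0,1\}^d\to\{0,1\}$ of the form $h(x)=\bigwedge_{j=1}^l\bigvee_{i\in A_j}x_i$ with $A_1,\dots,A_l\subseteq\{1,\dots,d\}$ pairwise disjoint and $|A_j|=m$ for all $j$. The elements of $\mathcal{X}$ are called tests. For a nonempty finite set $V$, $\mathbb{E}_{h\in V}[f(h)]=\frac{1}{|V|}\sum_{h\in V}f(h)$. For tests $x,x'$ let $\Delta(x,x')=\{h\in\mathcal{H}: h(x)=0 \wedge h(x')=1\}$. For $\alpha\in(0,\frac12]$, define a directed graph on $\mathcal{X}$ with a directed edge $(x,x')$ iff for every $V\subseteq\Delta(x,x')$, either $|V|\le 1$ or there exists a test $\hat x\in\mathcal{X}$ with $\mathbb{E}_{h\in V}[h(\hat x)]\in[\alpha,1-\alpha]$. The problem is $\frac1\alpha$-split-neighborly if this graph is strongly connected. *)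

theory Defs
  imports
    Complex_Main
    "HOL-Library.FuncSet"
    "HOL-Library.Disjoint_Sets"
    "Graph_Theory.Digraph_Component"
    "Graph_Theory.Pair_Digraph"
begin

text \<open>
  The values 0 and 1 are rendered as \<open>False\<close> and \<open>True\<close>.
  A problem is a pair \<open>(H, X)\<close> of a finite set of hypotheses and a set of tests.
\<close>

definition expect :: "'h set \<Rightarrow> ('h \<Rightarrow> real) \<Rightarrow> real" where
  "expect V f = (\<Sum>h\<in>V. f h) / real (card V)"

definition Delta :: "('x \<Rightarrow> bool) set \<Rightarrow> 'x \<Rightarrow> 'x \<Rightarrow> ('x \<Rightarrow> bool) set" where
  "Delta H x x' = {h \<in> H. \<not> h x \<and> h x'}"

text \<open>
  Only meaningful for finite \<open>H\<close>: the cardinality of an infinite \<open>V\<close> is 0 by convention.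
\<close>

definition split_graph :: "real \<Rightarrow> ('x \<Rightarrow> bool) set \<Rightarrow> 'x set \<Rightarrow> 'x pair_pre_digraph" where
  "split_graph \<alpha> H X =
     \<lparr> pverts = X,
       parcs = {(x, x') \<in> X \<times> X.
         \<forall>V \<subseteq> Delta H x x'.
           card V \<le> 1 \<or> (\<exists>y\<in>X. expect V (\<lambda>h. of_bool (h y)) \<in> {\<alpha>..1 - \<alpha>})} \<rparr>"

definition split_neighborly :: "real \<Rightarrow> ('x \<Rightarrow> bool) set \<Rightarrow> 'x set \<Rightarrow> bool" where
  "split_neighborly k H X \<longleftrightarrow>
     (\<exists>\<alpha>\<in>{0<..1/2}. k = 1 / \<alpha> \<and> strongly_connected (with_proj (split_graph \<alpha> H X)))"

definition tests :: "nat \<Rightarrow> (nat \<Rightarrow> bool) set" where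
  "tests d = {1..d} \<rightarrow>\<^sub>E UNIV"

text \<open>
  Hypotheses are functions on the tests, hence \<open>restrict\<close>: two of them are the same element
  of the set below exactly if they agree on all tests.
\<close>

definition conj_of_disj :: "nat \<Rightarrow> nat \<Rightarrow> (nat \<Rightarrow> nat set) \<Rightarrow> (nat \<Rightarrow> bool) \<Rightarrow> bool" where
  "conj_of_disj d l A = restrict (\<lambda>x. \<forall>j\<in>{1..l}. \<exists>i\<in>A j. x i) (tests d)"

definition hypotheses :: "nat \<Rightarrow> nat \<Rightarrow> nat \<Rightarrow> ((nat \<Rightarrow> bool) \<Rightarrow> bool) set" where
  "hypotheses d m l =
     {conj_of_disj d l A | A.
        (\<forall>j\<in>{1..l}. A j \<subseteq> {1..d} \<and> card (A j) = m) \<and> disjoint_family_on A {1..l}}"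

lemma finite_hypotheses: "finite (hypotheses d m l)"
proof (rule finite_subset)
  show "hypotheses d m l \<subseteq> tests d \<rightarrow>\<^sub>E UNIV"
    by (auto simp: hypotheses_def conj_of_disj_def)
  show "finite (tests d \<rightarrow>\<^sub>E (UNIV :: bool set))"
    by (intro finite_PiE) (auto simp: tests_def intro: finite_PiE)
qed

end

theory Submission
  imports Defs
begin

text \<open>
  Removing variables from a test never needs a split, and the zero test reaches the all-ones test
  by adding variables one at a time, so it suffices to treat an edge from \<open>y\<close> to \<open>insert a y\<close>.
  Suppose that no test splits \<open>V \<subseteq> \<Delta>(y, insert a y)\<close>, so that every test has value 0 or value 1
  on more than a fraction \<open>1 - \<alpha>\<close> of \<open>V\<close>. If most hypotheses fail on \<open>y\<close> and hold on
  \<open>insert a y\<close>, then each of these has exactly one clause missing \<open>y\<close>; adding variables to \<open>y\<close>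
  shows that this clause is the same for all but a further fraction \<open>\<alpha>\<close> of \<open>V\<close>. Keeping one
  representative of every clause found so far and deleting further variables
  until the value drops yields the next common clause, at the cost of a fraction \<open>3 \<alpha>\<close>. After \<open>l\<close> clauses
  a fraction of more than \<open>1 - (1 + 3 (l - 1)) \<alpha> = m \<alpha>\<close> of \<open>V\<close> consists of one single hypothesis.
  This is impossible if \<open>\<alpha> |V| > 1\<close>, and otherwise any test separating two hypotheses splits \<open>V\<close>.
\<close>

section \<open>Hypotheses as families of clauses, tests as sets of variables\<close>

text \<open>Here \<open>F\<close> is the set of clauses of a hypothesis and \<open>y\<close> the set
  of variables to which a test gives the value 1, so this is the value of the hypothesis on the
  test.\<close>

definition hits :: "'a set set \<Rightarrow> 'a set \<Rightarrow> bool" where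
  "hits F y \<longleftrightarrow> (\<forall>c\<in>F. c \<inter> y \<noteq> {})"

text \<open>\<open>D\<close> is the one clause responsible for the value 0 on \<open>y\<close>, and
  adding \<open>a\<close> repairs it.\<close>

definition unique_missed :: "'a set set \<Rightarrow> 'a set \<Rightarrow> 'a \<Rightarrow> 'a set \<Rightarrow> bool" where
  "unique_missed F y a D \<longleftrightarrow> D \<in> F \<and> a \<in> D \<and> D \<inter> y = {} \<and> (\<forall>c\<in>F - {D}. c \<inter> y \<noteq> {})"

lemma hits_mono: "hits F y \<Longrightarrow> y \<subseteq> z \<Longrightarrow> hits F z"
  unfolding hits_def by blast

text \<open>All clauses other than \<open>D\<close> already meet \<open>y\<close>, so the added
  variables matter for \<open>D\<close> only.\<close>

lemma hits_Un_iff: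
  assumes "unique_missed F y a D"
  shows "hits F (y \<union> S) \<longleftrightarrow> D \<inter> S \<noteq> {}"
proof -
  have D: "D \<in> F" "D \<inter> y = {}" "\<And>c. c \<in> F \<Longrightarrow> c \<noteq> D \<Longrightarrow> c \<inter> y \<noteq> {}"
    using assms unfolding unique_missed_def by simp_all
  have "c \<inter> (y \<union> S) \<noteq> {}" if "c \<in> F" "c \<noteq> D" for c
    using D(3)[OF that] by (simp add: Int_Un_distrib)
  moreover have "D \<inter> (y \<union> S) = D \<inter> S"
    using D(2) by (simp add: Int_Un_distrib)
  ultimately show ?thesis
    using D(1) unfolding hits_def by metis
qed

text \<open>A missed clause must contain \<open>a\<close>, the only new variable. By disjointness no
  other clause contains \<open>a\<close>, so the others meet \<open>y\<close> itself.\<close>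

lemma ex_unique_missed:
  assumes "disjoint F" and "\<not> hits F y" and "hits F (insert a y)"
  shows "\<exists>D. unique_missed F y a D"
proof -
  obtain D where D: "D \<in> F" "D \<inter> y = {}"
    using assms(2) unfolding hits_def by blast
  have a: "a \<in> D"
    using assms(3) D unfolding hits_def by blast
  have "c \<inter> y \<noteq> {}" if "c \<in> F - {D}" for c
  proof -
    have "c \<inter> D = {}"
      using that D(1) assms(1) by (auto dest: disjointD)
    then show ?thesis
      using that a assms(3) unfolding hits_def by blast
  qed
  then show ?thesis
    using D a unfolding unique_missed_def by blast
qed

section \<open>Counting in a finite collection of clause families\<close>

locale clause_families =
  fixes V :: "'a set set set" and U :: "'a set" and m l :: nat
  assumes finite_V: "finite V"
    and finite_U: "finite U"
    and m_pos: "m \<ge> 1"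
    and l_pos: "l \<ge> 1"
    and card_family: "F \<in> V \<Longrightarrow> card F = l"
    and disjoint_family: "F \<in> V \<Longrightarrow> disjoint F"
    and clause_subset: "F \<in> V \<Longrightarrow> c \<in> F \<Longrightarrow> c \<subseteq> U"
    and card_clause: "F \<in> V \<Longrightarrow> c \<in> F \<Longrightarrow> card c = m"
begin

text \<open>Real-valued because the counts are compared with a threshold that need not be an
  integer.\<close>

definition cnt :: "('a set set \<Rightarrow> bool) \<Rightarrow> real" where
  "cnt P = real (card {F \<in> V. P F})"

lemma finite_family: "F \<in> V \<Longrightarrow> finite F"
  using card_family[of F] l_pos by (intro card_ge_0_finite) simp

lemma finite_clause: "F \<in> V \<Longrightarrow> c \<in> F \<Longrightarrow> finite c"
  by (rule finite_subset[OF clause_subset finite_U])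

lemma cnt_mono: "(\<And>F. F \<in> V \<Longrightarrow> P F \<Longrightarrow> Q F) \<Longrightarrow> cnt P \<le> cnt Q"
  unfolding cnt_def of_nat_le_iff using finite_V by (intro card_mono) auto

lemma cnt_disj:
  assumes "\<And>F. F \<in> V \<Longrightarrow> P F \<Longrightarrow> Q F \<or> R F"
  shows "cnt P \<le> cnt Q + cnt R"
proof -
  have "card {F \<in> V. P F} \<le> card ({F \<in> V. Q F} \<union> {F \<in> V. R F})"
    using finite_V assms by (intro card_mono) auto
  also have "\<dots> \<le> card {F \<in> V. Q F} + card {F \<in> V. R F}"
    by (rule card_Un_le)
  finally show ?thesis
    unfolding cnt_def by linarith
qed

lemma cnt_Bex_le:
  assumes "finite T"
  shows "cnt (\<lambda>F. \<exists>w\<in>T. R w F) \<le> (\<Sum>w\<in>T. cnt (R w))"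
proof -
  have "{F \<in> V. \<exists>w\<in>T. R w F} = (\<Union>w\<in>T. {F \<in> V. R w F})"
    by blast
  then show ?thesis
    unfolding cnt_def using card_UN_le[OF assms, of "\<lambda>w. {F \<in> V. R w F}"]
    by (simp flip: of_nat_sum)
qed

lemma cnt_not: "cnt (\<lambda>F. \<not> P F) = real (card V) - cnt P"
proof -
  have "card V = card ({F \<in> V. P F} \<union> {F \<in> V. \<not> P F})"
    by (rule arg_cong[of _ _ card]) blast
  also have "\<dots> = card {F \<in> V. P F} + card {F \<in> V. \<not> P F}"
    using finite_V by (intro card_Un_disjoint) auto
  finally show ?thesis
    unfolding cnt_def by simp
qed

lemma cnt_False:
  assumes "\<And>F. F \<in> V \<Longrightarrow> \<not> P F"
  shows "cnt P = 0"
proof -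
  have "{F \<in> V. P F} = {}"
    using assms by blast
  then show ?thesis
    unfolding cnt_def by (simp only: card.empty of_nat_0)
qed

lemma cnt_less_ex:
  assumes "cnt P < real (card V)"
  shows "\<exists>F\<in>V. \<not> P F"
proof (rule ccontr)
  assume "\<not> ?thesis"
  then have "{F \<in> V. P F} = V"
    by blast
  then show False
    using assms by (simp add: cnt_def)
qed

text \<open>Both families have \<open>l\<close> clauses, so some clause \<open>c\<close> of
  \<open>F\<close> is not in \<open>F'\<close>. The complement of \<open>c\<close> misses
  \<open>c\<close>, but a clause of \<open>F'\<close> missed by it would lie in \<open>c\<close> and
  equal it by cardinality.\<close>

lemma ex_separating_test:
  assumes "F \<in> V" "F' \<in> V" "F \<noteq> F'"
  shows "\<exists>y\<subseteq>U. \<not> hits F y \<and> hits F' y"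
proof -
  have "\<not> F \<subseteq> F'"
    using assms card_family finite_family card_subset_eq by metis
  then obtain c where c: "c \<in> F" "c \<notin> F'"
    by blast
  have "\<not> hits F (U - c)"
    using c unfolding hits_def by blast
  moreover have "hits F' (U - c)"
    unfolding hits_def
  proof (rule ballI, rule notI)
    fix c' assume c': "c' \<in> F'" "c' \<inter> (U - c) = {}"
    then have "c' \<subseteq> c"
      using clause_subset assms(2) by blast
    then have "c' = c"
      using c c' assms card_clause finite_clause card_subset_eq by metis
    then show False
      using c c' by simp
  qed
  ultimately show ?thesis
    by blast
qed

text \<open>Variables of \<open>y\<close> chosen from different clauses are different by
  disjointness.\<close>

lemma hits_card_ge:
  assumes "F \<in> V" "hits F y" "finite y"
  shows "l \<le> card y"
proof -
  have "\<forall>c\<in>F. \<exists>v. v \<in> c \<inter> y"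
    using assms(2) unfolding hits_def by blast
  then obtain f where f: "\<And>c. c \<in> F \<Longrightarrow> f c \<in> c \<inter> y"
    by metis
  have "inj_on f F"
  proof (rule inj_onI)
    fix c c' assume "c \<in> F" "c' \<in> F" "f c = f c'"
    then show "c = c'"
      using f[of c] f[of c'] disjointD[OF disjoint_family[OF assms(1)], of c c'] by force
  qed
  then show ?thesis
    using card_inj_on_le[of f F y] f card_family assms by auto
qed

end

section \<open>Consequences of the absence of a splitting test\<close>

text \<open>The threshold \<open>q\<close> stands for \<open>\<alpha> * card V\<close>, so
  \<open>low_or_high\<close> says that no test splits \<open>V\<close>.\<close>

locale unsplit = clause_families +
  fixes q :: real
  assumes q_gt: "q > 1"
    and q_scale: "(real m + 1 + 3 * (real l - 1)) * q = real (card V)"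
    and low_or_high: "y \<subseteq> U \<Longrightarrow>
      cnt (\<lambda>F. hits F y) < q \<or> cnt (\<lambda>F. hits F y) > real (card V) - q"
begin

text \<open>At most \<open>e\<close> families fail to switch from 0 to 1 when \<open>a\<close> is
  added. Each further variable \<open>w\<close> is classified by whether adding \<open>w\<close>
  instead of \<open>a\<close> leaves most families at 0 (\<open>low\<close>) or brings most to 1
  (\<open>high\<close>); the common clause is \<open>a\<close> together with the high
  variables.\<close>

lemma common_missed_clause:
  assumes y: "y \<subseteq> U" and a: "a \<in> U" "a \<notin> y"
    and few: "cnt (\<lambda>F. \<not> (\<not> hits F y \<and> hits F (insert a y))) \<le> e"
    and size_m: "real m * q + e \<le> real (card V)"
    and size_3: "m = 1 \<or> 3 * q + e \<le> real (card V)"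
  shows "\<exists>D. a \<in> D \<and> cnt (\<lambda>F. \<not> unique_missed F y a D) < e + q"
proof (cases "m = 1")
  \<comment> \<open>A one-variable clause can only be \<open>{a}\<close>. This case is separate
    because \<open>3 * q + e\<close> may exceed \<open>card V\<close>: for \<open>m = l = 1\<close>,
    \<open>card V\<close> is \<open>2 * q\<close>.\<close>
  case True
  have "unique_missed F y a {a}" if F: "F \<in> V" and B: "\<not> hits F y" "hits F (insert a y)" for F
  proof -
    obtain D where D: "unique_missed F y a D"
      using ex_unique_missed[OF disjoint_family[OF F] B] by blast
    then have "D = {a}"
      using card_clause[OF F, of D] True unfolding unique_missed_def
      by (auto simp: card_1_singleton_iff)
    then show ?thesis
      using D by simp
  qed
  then have "cnt (\<lambda>F. \<not> unique_missed F y a {a}) \<le> e"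
    by (intro order_trans[OF cnt_mono few]) blast
  then show ?thesis
    using q_gt by (intro exI[of _ "{a}"]) auto
next
  case False
  define B where "B F \<longleftrightarrow> \<not> hits F y \<and> hits F (insert a y)" for F
  have few_B: "cnt (\<lambda>F. \<not> B F) \<le> e"
    using few unfolding B_def .
  have miss: "\<exists>D. unique_missed F y a D" if "F \<in> V" "B F" for F
    using ex_unique_missed[OF disjoint_family[OF that(1)]] that(2) unfolding B_def by simp
  define low where "low = {w \<in> U - insert a y. cnt (\<lambda>F. hits F (y \<union> {w})) < q}"
  define high where "high = U - insert a y - low"
  have high_few: "cnt (\<lambda>F. \<not> hits F (y \<union> {w})) < q" if "w \<in> high" for w
  proof -
    have "y \<union> {w} \<subseteq> U"
      using that y unfolding high_def by blast
    moreover have "\<not> cnt (\<lambda>F. hits F (y \<union> {w})) < q"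
      using that unfolding high_def low_def by blast
    ultimately show ?thesis
      using low_or_high[of "y \<union> {w}"] cnt_not[of "\<lambda>F. hits F (y \<union> {w})"] by linarith
  qed
  have "finite low"
    using finite_U unfolding low_def by simp
  \<comment> \<open>Errors do not accumulate: one more low variable keeps the count below
    \<open>2 * q + e\<close>, hence below the upper threshold, and \<open>low_or_high\<close> pushes
    it back below \<open>q\<close>.\<close>
  have "cnt (\<lambda>F. hits F (y \<union> S)) < q" if "finite S" "S \<subseteq> low" for S
    using that
  proof (induction S rule: finite_induct)
    case empty
    have "cnt (\<lambda>F. hits F y) \<le> cnt (\<lambda>F. \<not> B F)"
      by (rule cnt_mono) (simp add: B_def)
    then have "cnt (\<lambda>F. hits F y) \<le> real (card V) - q"
      using few_B size_3 False q_gt by linarith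
    then show ?case
      using low_or_high[OF y] by simp
  next
    case (insert w S)
    have sub: "y \<union> insert w S \<subseteq> U"
      using insert.prems y unfolding low_def by blast
    have "cnt (\<lambda>F. hits F (y \<union> insert w S))
        \<le> cnt (\<lambda>F. hits F (y \<union> S)) + cnt (\<lambda>F. hits F (y \<union> {w}) \<or> \<not> B F)"
    proof (rule cnt_disj)
      fix F assume F: "F \<in> V" "hits F (y \<union> insert w S)"
      show "hits F (y \<union> S) \<or> hits F (y \<union> {w}) \<or> \<not> B F"
      proof (cases "B F")
        case True
        then obtain D where "unique_missed F y a D"
          using miss F by blast
        note iff = hits_Un_iff[OF this]
        show ?thesis
          using F(2) iff[of S] iff[of "{w}"] iff[of "insert w S"] by blast
      qed simp
    qed
    also have "cnt (\<lambda>F. hits F (y \<union> {w}) \<or> \<not> B F)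
        \<le> cnt (\<lambda>F. hits F (y \<union> {w})) + cnt (\<lambda>F. \<not> B F)"
      by (rule cnt_disj) blast
    finally have "cnt (\<lambda>F. hits F (y \<union> insert w S)) \<le>
        cnt (\<lambda>F. hits F (y \<union> S)) + (cnt (\<lambda>F. hits F (y \<union> {w})) + cnt (\<lambda>F. \<not> B F))"
      by simp
    moreover have "cnt (\<lambda>F. hits F (y \<union> S)) < q"
      using insert by blast
    moreover have "cnt (\<lambda>F. hits F (y \<union> {w})) < q"
      using insert.prems unfolding low_def by blast
    ultimately show ?case
      using low_or_high[OF sub] few_B size_3 False by linarith
  qed
  from this[of low] have cnt_low: "cnt (\<lambda>F. hits F (y \<union> low)) < q"
    using \<open>finite low\<close> by blast
  \<comment> \<open>With \<open>m\<close> high variables, fewer than \<open>m * q + e\<close>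
    families would be exceptional for one of them or fail to switch. Any other family would have a
    missed clause with these \<open>m\<close> variables and \<open>a\<close>, one too many.\<close>
  have "card high < m"
  proof (rule ccontr)
    assume "\<not> ?thesis"
    then obtain T where T: "T \<subseteq> high" "card T = m" "finite T"
      by (meson not_less obtain_subset_with_card_n)
    have "T \<noteq> {}"
      using T m_pos by auto
    have "cnt (\<lambda>F. \<exists>w\<in>T. \<not> hits F (y \<union> {w})) \<le> (\<Sum>w\<in>T. cnt (\<lambda>F. \<not> hits F (y \<union> {w})))"
      by (rule cnt_Bex_le) (rule T)
    also have "\<dots> < (\<Sum>w\<in>T. q)"
      using T \<open>T \<noteq> {}\<close> high_few by (intro sum_strict_mono) auto
    also have "\<dots> = real m * q"
      using T by simp
    finally have "cnt (\<lambda>F. (\<exists>w\<in>T. \<not> hits F (y \<union> {w})) \<or> \<not> B F) < real (card V)"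
      using cnt_disj[of "\<lambda>F. (\<exists>w\<in>T. \<not> hits F (y \<union> {w})) \<or> \<not> B F"
          "\<lambda>F. \<exists>w\<in>T. \<not> hits F (y \<union> {w})" "\<lambda>F. \<not> B F"] few_B size_m by force
    then obtain F where F: "F \<in> V" "B F" "\<And>w. w \<in> T \<Longrightarrow> hits F (y \<union> {w})"
      using cnt_less_ex by blast
    obtain D where D: "unique_missed F y a D"
      using miss F by blast
    have "w \<in> D" if "w \<in> T" for w
      using F(3)[OF that] hits_Un_iff[OF D, of "{w}"] by simp
    moreover have "a \<in> D"
      using D unfolding unique_missed_def by blast
    ultimately have "insert a T \<subseteq> D"
      by blast
    moreover have "a \<notin> T"
      using T unfolding high_def by blast
    moreover have "finite D" "card D = m"
      using D finite_clause[OF F(1)] card_clause[OF F(1)] unfolding unique_missed_def by blast+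
    ultimately show False
      using card_mono[of D "insert a T"] T(2,3) by simp
  qed
  have "finite high"
    using finite_U unfolding high_def by simp
  \<comment> \<open>The missed clause avoids \<open>low\<close>, so it lies in
    \<open>insert a high\<close>, a set of at most \<open>m\<close> elements; having
    \<open>m\<close> elements, it is that set.\<close>
  have "unique_missed F y a (insert a high)"
    if F: "F \<in> V" "B F" "\<not> hits F (y \<union> low)" for F
  proof -
    obtain D where D: "unique_missed F y a D"
      using miss F by blast
    have "D \<inter> low = {}"
      using F(3) hits_Un_iff[OF D, of low] by simp
    then have "D \<subseteq> insert a high"
      using D clause_subset[OF F(1), of D] unfolding unique_missed_def high_def by blast
    moreover have "card D = m"
      using D card_clause[OF F(1)] unfolding unique_missed_def by blast
    moreover have "card (insert a high) \<le> m"
      using \<open>card high < m\<close> \<open>finite high\<close> by (simp add: card_insert_if)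
    ultimately have "D = insert a high"
      using \<open>finite high\<close> by (intro card_seteq) auto
    then show ?thesis
      using D by simp
  qed
  then have "cnt (\<lambda>F. \<not> unique_missed F y a (insert a high))
      \<le> cnt (\<lambda>F. \<not> B F) + cnt (\<lambda>F. hits F (y \<union> low))"
    by (intro cnt_disj) blast
  then show ?thesis
    using few_B cnt_low by (intro exI[of _ "insert a high"]) auto
qed

text \<open>Deleting the elements of \<open>z\<close> one at a time ends at \<open>I\<close>, which
  is not above \<open>t\<close>, so some deletion crosses the threshold.\<close>

lemma ex_value_drop:
  assumes "finite z" and "cnt (\<lambda>F. hits F (z \<union> I)) > t" and "\<not> cnt (\<lambda>F. hits F I) > t"
  shows "\<exists>z' a. insert a z' \<subseteq> z \<and> cnt (\<lambda>F. hits F (insert a (z' \<union> I))) > t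
    \<and> \<not> cnt (\<lambda>F. hits F (z' \<union> I)) > t"
  using assms
proof (induction z rule: finite_induct)
  case empty
  then show ?case by simp
next
  case (insert a z)
  show ?case
  proof (cases "cnt (\<lambda>F. hits F (z \<union> I)) > t")
    case True
    then show ?thesis
      using insert by blast
  next
    case False
    then show ?thesis
      using insert.prems by (intro exI[of _ z] exI[of _ a]) auto
  qed
qed

text \<open>\<open>I\<close> holds representatives of the clauses in \<open>Fs\<close>. Keeping
  \<open>I\<close> in every later test forces the next missed clause to be new, and its size bound
  ensures that \<open>I\<close> alone satisfies no family while clauses remain to be found.\<close>

lemma common_clauses:
  assumes y0: "y0 \<subseteq> U" "a0 \<in> U"
    and Delta: "\<And>F. F \<in> V \<Longrightarrow> \<not> hits F y0 \<and> hits F (insert a0 y0)"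
    and "r < l"
  shows "\<exists>Fs I z. finite Fs \<and> card Fs = Suc r \<and> z \<union> I \<subseteq> U \<and> card I \<le> Suc r \<and>
    (\<forall>c\<in>Fs. c \<inter> I \<noteq> {}) \<and> cnt (\<lambda>F. hits F (z \<union> I)) > real (card V) - q \<and>
    cnt (\<lambda>F. \<not> Fs \<subseteq> F) < (1 + 3 * real r) * q"
  using \<open>r < l\<close>
proof (induction r)
  case 0
  have "V \<noteq> {}"
    using q_scale q_gt m_pos l_pos by auto
  then have "a0 \<notin> y0"
    using Delta by (metis insert_absorb ex_in_conv)
  \<comment> \<open>Every family in \<open>V\<close> switches at \<open>a0\<close>, so the first
    clause is found with \<open>e = 0\<close>.\<close>
  moreover have "cnt (\<lambda>F. \<not> (\<not> hits F y0 \<and> hits F (insert a0 y0))) \<le> 0"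
    using Delta by (subst cnt_False) auto
  moreover have "real m * q + 0 \<le> real (card V)"
    unfolding q_scale[symmetric] using q_gt l_pos by (simp add: mult_right_mono)
  moreover have "m = 1 \<or> 3 * q + 0 \<le> real (card V)"
    unfolding q_scale[symmetric] using q_gt l_pos m_pos
    by (cases "m = 1") (auto intro!: mult_right_mono)
  ultimately obtain D where D: "a0 \<in> D" "cnt (\<lambda>F. \<not> unique_missed F y0 a0 D) < 0 + q"
    using common_missed_clause[of y0 a0 0] y0 by blast
  have "cnt (\<lambda>F. \<not> {D} \<subseteq> F) \<le> cnt (\<lambda>F. \<not> unique_missed F y0 a0 D)"
    by (rule cnt_mono) (auto simp: unique_missed_def)
  moreover have "cnt (\<lambda>F. hits F (y0 \<union> {a0})) = real (card V)"
    using cnt_not[of "\<lambda>F. hits F (y0 \<union> {a0})"] cnt_False[of "\<lambda>F. \<not> hits F (y0 \<union> {a0})"] Delta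
    by auto
  ultimately show ?case
    using D y0 q_gt
    by (intro exI[of _ "{D}"] exI[of _ "{a0}"] exI[of _ y0]) auto
next
  case (Suc r)
  then obtain Fs I z where IH: "finite Fs" "card Fs = Suc r" "z \<union> I \<subseteq> U" "card I \<le> Suc r"
    "\<forall>c\<in>Fs. c \<inter> I \<noteq> {}" "cnt (\<lambda>F. hits F (z \<union> I)) > real (card V) - q"
    "cnt (\<lambda>F. \<not> Fs \<subseteq> F) < (1 + 3 * real r) * q"
    by auto
  have fin: "finite z" "finite I"
    using IH(3) finite_U finite_subset by auto
  have scale: "c * q \<le> real (card V)" if "c \<le> real m + 1 + 3 * (real l - 1)" for c
    unfolding q_scale[symmetric] using that q_gt by (intro mult_right_mono) auto
  have l: "real l \<ge> real r + 2"
    using Suc.prems by linarith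
  have m: "real m \<ge> 1"
    using m_pos by simp
  \<comment> \<open>\<open>I\<close> has fewer than \<open>l\<close> variables, so deleting all of
    \<open>z\<close> would give the value 0 everywhere.\<close>
  have "cnt (\<lambda>F. hits F I) = 0"
    using hits_card_ge[OF _ _ fin(2)] IH(4) Suc.prems by (intro cnt_False) fastforce
  then have "\<not> cnt (\<lambda>F. hits F I) > real (card V) - q"
    using scale[of 1] l m by auto
  then obtain z' a where z': "insert a z' \<subseteq> z"
    "cnt (\<lambda>F. hits F (insert a (z' \<union> I))) > real (card V) - q"
    "\<not> cnt (\<lambda>F. hits F (z' \<union> I)) > real (card V) - q"
    using ex_value_drop[OF fin(1) IH(6)] by blast
  define y where "y = z' \<union> I"
  have y: "y \<subseteq> U" "a \<in> U" "a \<notin> y"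
    using z' IH(3) by (auto simp: y_def insert_absorb)
  \<comment> \<open>Two exceptional sets, each smaller than \<open>q\<close>, give
    \<open>e = 2 * q\<close>; the clause lemma adds another \<open>q\<close>, whence the cost
    \<open>3 * q\<close> per clause.\<close>
  have "cnt (\<lambda>F. hits F y) < q"
    using low_or_high[OF y(1)] z'(3) unfolding y_def by blast
  moreover have "cnt (\<lambda>F. \<not> hits F (insert a y)) < q"
    using z'(2) cnt_not[of "\<lambda>F. hits F (insert a y)"] unfolding y_def by simp
  moreover have "cnt (\<lambda>F. \<not> (\<not> hits F y \<and> hits F (insert a y)))
      \<le> cnt (\<lambda>F. hits F y) + cnt (\<lambda>F. \<not> hits F (insert a y))"
    by (rule cnt_disj) blast
  ultimately have "cnt (\<lambda>F. \<not> (\<not> hits F y \<and> hits F (insert a y))) \<le> 2 * q"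
    by linarith
  moreover have "real m * q + 2 * q \<le> real (card V)"
    using scale[of "real m + 2"] l by (simp add: algebra_simps)
  moreover have "m = 1 \<or> 3 * q + 2 * q \<le> real (card V)"
    using scale[of 5] l m by simp
  ultimately obtain D where D: "a \<in> D" "cnt (\<lambda>F. \<not> unique_missed F y a D) < 2 * q + q"
    using common_missed_clause[OF y] by blast
  \<comment> \<open>Some family is not exceptional, and in it \<open>D\<close> misses
    \<open>y\<close>, which contains \<open>I\<close>.\<close>
  have "D \<inter> I = {}"
  proof -
    have "cnt (\<lambda>F. \<not> unique_missed F y a D) < real (card V)"
      using D(2) scale[of 3] l m by simp
    then show ?thesis
      using cnt_less_ex unfolding unique_missed_def y_def by blast
  qed
  then have "D \<notin> Fs"
    using IH(5) by blast
  have "cnt (\<lambda>F. \<not> insert D Fs \<subseteq> F)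
      \<le> cnt (\<lambda>F. \<not> Fs \<subseteq> F) + cnt (\<lambda>F. \<not> unique_missed F y a D)"
    by (rule cnt_disj) (auto simp: unique_missed_def)
  also have "\<dots> < (1 + 3 * real r) * q + (2 * q + q)"
    using D(2) IH(7) by linarith
  also have "\<dots> = (1 + 3 * real (Suc r)) * q"
    by (simp add: algebra_simps)
  finally have "cnt (\<lambda>F. \<not> insert D Fs \<subseteq> F) < (1 + 3 * real (Suc r)) * q" .
  moreover have "card (insert D Fs) = Suc (Suc r)"
    using IH(1,2) \<open>D \<notin> Fs\<close> by simp
  moreover have "card (insert a I) \<le> Suc (Suc r)"
    using IH(4) fin by (simp add: card_insert_if)
  moreover have "\<forall>c\<in>insert D Fs. c \<inter> insert a I \<noteq> {}"
    using D(1) IH(5) by blast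
  moreover have "z' \<union> insert a I \<subseteq> U"
    using y unfolding y_def by blast
  moreover have "cnt (\<lambda>F. hits F (z' \<union> insert a I)) > real (card V) - q"
    using z'(2) by simp
  ultimately show ?case
    using IH(1) by (intro exI[of _ "insert D Fs"] exI[of _ "insert a I"] exI[of _ z']) simp
qed

text \<open>A family containing \<open>l\<close> common clauses equals the set of these clauses, so
  there is at most one. Yet the bound leaves more than \<open>m * q > 1\<close> such
  families.\<close>

lemma no_single_variable_Delta:
  assumes "y \<subseteq> U" "a \<in> U" "\<And>F. F \<in> V \<Longrightarrow> \<not> hits F y \<and> hits F (insert a y)"
  shows False
proof -
  obtain Fs where Fs: "finite Fs" "card Fs = l"
    "cnt (\<lambda>F. \<not> Fs \<subseteq> F) < (1 + 3 * (real l - 1)) * q"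
    using common_clauses[OF assms, of "l - 1"] l_pos by (auto simp: of_nat_diff)
  have "{F \<in> V. Fs \<subseteq> F} \<subseteq> {Fs}"
  proof (rule subsetI)
    fix F assume "F \<in> {F \<in> V. Fs \<subseteq> F}"
    then show "F \<in> {Fs}"
      using card_subset_eq[of F Fs] card_family[of F] finite_family[of F] Fs(2) by simp
  qed
  then have "card {F \<in> V. Fs \<subseteq> F} \<le> 1"
    using card_mono[of "{Fs}" "{F \<in> V. Fs \<subseteq> F}"] by simp
  then have "cnt (\<lambda>F. Fs \<subseteq> F) \<le> 1"
    unfolding cnt_def by simp
  moreover have "real m * q \<ge> 1 * q"
    using m_pos q_gt by (intro mult_right_mono) auto
  moreover have "real (card V) - cnt (\<lambda>F. Fs \<subseteq> F) < (1 + 3 * (real l - 1)) * q"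
    using Fs(3) unfolding cnt_not .
  moreover have "real (card V) = real m * q + (1 + 3 * (real l - 1)) * q"
    unfolding q_scale[symmetric] by (simp add: algebra_simps)
  ultimately show False
    using q_gt by linarith
qed

end

section \<open>Existence of a splitting test for one added variable\<close>

context clause_families
begin

lemma ex_splitting_test:
  assumes y: "y \<subseteq> U" "a \<in> U" "\<And>F. F \<in> V \<Longrightarrow> \<not> hits F y \<and> hits F (insert a y)"
    and V: "card V > 1"
    and q: "(real m + 1 + 3 * (real l - 1)) * q = real (card V)"
  shows "\<exists>y\<subseteq>U. cnt (\<lambda>F. hits F y) \<in> {q..real (card V) - q}"
proof (rule ccontr)
  assume contra: "\<not> ?thesis"
  show False
  proof (cases "q > 1")
    case True
    interpret unsplit V U m l q
    proof
      show "q > 1"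
        by (rule True)
      show "(real m + 1 + 3 * (real l - 1)) * q = real (card V)"
        by (rule q)
      show "cnt (\<lambda>F. hits F y) < q \<or> cnt (\<lambda>F. hits F y) > real (card V) - q" if "y \<subseteq> U" for y
        using contra that by (meson atLeastAtMost_iff not_less)
    qed
    show False
      using no_single_variable_Delta[OF y] .
  next
    case False
    \<comment> \<open>For \<open>q \<le> 1\<close> it suffices that a test has both values on
      \<open>V\<close>: its count then lies between 1 and \<open>card V - 1\<close>.\<close>
    obtain F F' where F: "F \<in> V" "F' \<in> V" "F \<noteq> F'"
      using V card_le_Suc0_iff_eq[OF finite_V] by (auto simp: not_le[symmetric])
    then obtain z where z: "z \<subseteq> U" "\<not> hits F z" "hits F' z"
      using ex_separating_test by blast
    have "0 < card {F \<in> V. hits F z}" "card {F \<in> V. hits F z} < card V"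
      using F z finite_V by (auto simp: card_gt_0_iff intro!: psubset_card_mono)
    then have "cnt (\<lambda>F. hits F z) \<in> {q..real (card V) - q}"
      using False unfolding cnt_def by auto
    then show False
      using contra z(1) by blast
  qed
qed

end

section \<open>Translation between clause families and the given hypotheses\<close>

definition test_of :: "nat \<Rightarrow> nat set \<Rightarrow> nat \<Rightarrow> bool" where
  "test_of d y = restrict (\<lambda>i. i \<in> y) {1..d}"

lemma test_of_in_tests: "test_of d y \<in> tests d"
  unfolding test_of_def tests_def by auto

lemma tests_cases:
  assumes "x \<in> tests d"
  obtains y where "y \<subseteq> {1..d}" "x = test_of d y"
proof
  show "x = test_of d {i \<in> {1..d}. x i}"
    using assms unfolding test_of_def tests_def by (auto simp: fun_eq_iff PiE_def extensional_def)
qed auto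

lemma conj_of_disj_test_of:
  assumes "\<And>j. j \<in> {1..l} \<Longrightarrow> A j \<subseteq> {1..d}"
  shows "conj_of_disj d l A (test_of d y) \<longleftrightarrow> hits (A ` {1..l}) y"
proof -
  have "(\<exists>i\<in>A j. test_of d y i) \<longleftrightarrow> A j \<inter> y \<noteq> {}" if "j \<in> {1..l}" for j
  proof -
    have "test_of d y i \<longleftrightarrow> i \<in> y" if "i \<in> A j" for i
      using assms[OF \<open>j \<in> {1..l}\<close>] that unfolding test_of_def by (auto simp: restrict_def)
    then show ?thesis
      by blast
  qed
  then show ?thesis
    unfolding conj_of_disj_def hits_def using test_of_in_tests by simp
qed

definition clause_family :: "nat \<Rightarrow> nat \<Rightarrow> nat \<Rightarrow> nat set set \<Rightarrow> bool" where
  "clause_family d m l F \<longleftrightarrow> card F = l \<and> disjoint F \<and> (\<forall>c\<in>F. c \<subseteq> {1..d} \<and> card c = m)"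

lemma hypothesis_family:
  assumes "h \<in> hypotheses d m l" and "m \<ge> 1"
  shows "\<exists>F. clause_family d m l F \<and> (\<forall>y. h (test_of d y) \<longleftrightarrow> hits F y)"
proof -
  obtain A where A: "h = conj_of_disj d l A" "\<And>j. j \<in> {1..l} \<Longrightarrow> A j \<subseteq> {1..d} \<and> card (A j) = m"
    "disjoint_family_on A {1..l}"
    using assms(1) unfolding hypotheses_def by blast
  \<comment> \<open>Disjoint sets are distinct once they are nonempty, so the image has exactly
    \<open>l\<close> clauses.\<close>
  have "A j \<noteq> {}" if "j \<in> {1..l}" for j
    using A(2)[OF that] assms(2) by auto
  then have "inj_on A {1..l}"
    using A(3) unfolding disjoint_family_on_def inj_on_def by (metis inf.idem)
  then have "card (A ` {1..l}) = l"
    by (simp add: card_image)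
  moreover have "disjoint (A ` {1..l})"
    using A(3) by (rule disjoint_family_on_disjoint_image)
  ultimately have "clause_family d m l (A ` {1..l})"
    using A(2) unfolding clause_family_def by blast
  moreover have "h (test_of d y) \<longleftrightarrow> hits (A ` {1..l}) y" for y
    unfolding A(1) using A(2) by (intro conj_of_disj_test_of) blast
  ultimately show ?thesis
    by blast
qed

lemma hypotheses_eqI:
  assumes "h \<in> hypotheses d m l" "h' \<in> hypotheses d m l"
    and "\<And>y. h (test_of d y) = h' (test_of d y)"
  shows "h = h'"
proof
  fix x
  show "h x = h' x"
  proof (cases "x \<in> tests d")
    case True
    then show ?thesis
      using assms(3) by (metis tests_cases)
  next
    case False
    then show ?thesis
      using assms(1,2) unfolding hypotheses_def conj_of_disj_def by auto
  qed
qed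

lemma hypotheses_monotone:
  assumes "h \<in> hypotheses d m l" "m \<ge> 1" "y \<subseteq> z" "h (test_of d y)"
  shows "h (test_of d z)"
  using hypothesis_family[OF assms(1,2)] assms(3,4) hits_mono by metis

text \<open>Choosing a clause family for each hypothesis transfers the count bounds with
  \<open>q = card V / k\<close>; division by \<open>card V\<close> turns them into bounds on the
  expectation.\<close>

lemma ex_splitting_test_hypotheses:
  fixes d m l :: nat
  defines "k \<equiv> real m + 1 + 3 * (real l - 1)"
  assumes m: "m \<ge> 1" and l: "l \<ge> 1" and y: "y \<subseteq> {1..d}" and a: "a \<in> {1..d}"
    and V: "V \<subseteq> Delta (hypotheses d m l) (test_of d y) (test_of d (insert a y))" "card V > 1"
  shows "\<exists>x\<in>tests d. expect V (\<lambda>h. of_bool (h x)) \<in> {1 / k..1 - 1 / k}"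
proof -
  have VH: "V \<subseteq> hypotheses d m l"
    using V(1) unfolding Delta_def by blast
  have fin: "finite V"
    using VH finite_hypotheses finite_subset by blast
  have "\<forall>h\<in>V. \<exists>F. clause_family d m l F \<and> (\<forall>y. h (test_of d y) \<longleftrightarrow> hits F y)"
    using VH hypothesis_family[OF _ m] by blast
  then obtain f where f: "\<And>h. h \<in> V \<Longrightarrow> clause_family d m l (f h)"
    "\<And>h y. h \<in> V \<Longrightarrow> h (test_of d y) \<longleftrightarrow> hits (f h) y"
    by metis
  \<comment> \<open>Injectivity makes counts of families agree with counts of hypotheses.\<close>
  have inj: "inj_on f V"
  proof (rule inj_onI)
    fix h h' assume "h \<in> V" "h' \<in> V" "f h = f h'"
    then show "h = h'"
      using VH f(2)[of h] f(2)[of h'] by (intro hypotheses_eqI[of h d m l h']) auto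
  qed
  have card: "card (f ` V) = card V"
    using inj by (rule card_image)
  interpret clause_families "f ` V" "{1..d}" m l
    using fin m l f(1) unfolding clause_family_def by unfold_locales auto
  have k: "k > 0"
    using m l unfolding k_def by simp
  have "\<not> hits F y \<and> hits F (insert a y)" if "F \<in> f ` V" for F
    using that V(1) f(2) unfolding Delta_def by blast
  then obtain z where z: "z \<subseteq> {1..d}"
    "cnt (\<lambda>F. hits F z) \<in> {card V / k..card V - card V / k}"
    using ex_splitting_test[OF y a, of "card V / k"] V(2) k unfolding card k_def[symmetric] by auto
  have "{F \<in> f ` V. hits F z} = f ` {h \<in> V. h (test_of d z)}"
    using f(2) by blast
  then have "cnt (\<lambda>F. hits F z) = real (card {h \<in> V. h (test_of d z)})"
    unfolding cnt_def using card_image[OF inj_on_subset[OF inj, of "{h \<in> V. h (test_of d z)}"]] by simp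
  then have "expect V (\<lambda>h. of_bool (h (test_of d z))) = cnt (\<lambda>F. hits F z) / card V"
    unfolding expect_def using fin by (simp add: sum.If_cases of_bool_def Int_def)
  moreover have "cnt (\<lambda>F. hits F z) / card V \<in> {1 / k..1 - 1 / k}"
    using z(2) V(2) by (simp add: field_simps)
  ultimately show ?thesis
    using test_of_in_tests[of d z] by (intro bexI[of _ "test_of d z"]) simp_all
qed

section \<open>Strong connectivity of the split graph\<close>

theorem theorem4p2:
  fixes d m l :: nat
  assumes "d \<ge> 1" and "m \<ge> 1" and "l \<ge> 1" and "d \<ge> l * m"
  shows "split_neighborly (real m + 1 + 3 * (real l - 1)) (hypotheses d m l) (tests d)"
proof -
  define k where "k = real m + 1 + 3 * (real l - 1)"
  define G where "G = with_proj (split_graph (1 / k) (hypotheses d m l) (tests d))"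
  have k: "k \<ge> 2"
    using assms unfolding k_def by simp
  have verts: "verts G = tests d"
    unfolding G_def split_graph_def by simp
  have down: "test_of d z \<rightarrow>\<^bsub>G\<^esub> test_of d y" if "y \<subseteq> z" for y z
  proof -
    \<comment> \<open>By monotonicity no hypothesis gains value 1 on a smaller test, so the edge
      condition concerns only the empty \<open>V\<close>.\<close>
    have "Delta (hypotheses d m l) (test_of d z) (test_of d y) = {}"
      using hypotheses_monotone[OF _ assms(2) that] unfolding Delta_def by blast
    then show ?thesis
      unfolding G_def split_graph_def by (simp add: test_of_in_tests)
  qed
  have up: "test_of d y \<rightarrow>\<^bsub>G\<^esub> test_of d (insert a y)" if "y \<subseteq> {1..d}" "a \<in> {1..d}" for y a
  proof -
    have "card V \<le> 1 \<or> (\<exists>x\<in>tests d. expect V (\<lambda>h. of_bool (h x)) \<in> {1 / k..1 - 1 / k})"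
      if "V \<subseteq> Delta (hypotheses d m l) (test_of d y) (test_of d (insert a y))" for V
      using ex_splitting_test_hypotheses[OF assms(2,3) \<open>y \<subseteq> {1..d}\<close> \<open>a \<in> {1..d}\<close> that]
      unfolding k_def by force
    then show ?thesis
      unfolding G_def split_graph_def by (simp add: test_of_in_tests)
  qed
  interpret wf_digraph G
    unfolding G_def split_graph_def by unfold_locales auto
  have from_empty: "test_of d {} \<rightarrow>\<^sup>*\<^bsub>G\<^esub> test_of d y" if "finite y" "y \<subseteq> {1..d}" for y
    using that
  proof (induction y rule: finite_induct)
    case empty
    then show ?case
      by (simp add: verts test_of_in_tests)
  next
    case (insert a y)
    then show ?case
      using up[of y a] by (auto intro: reachable_adj_trans)
  qed
  \<comment> \<open>One edge leads down to the zero test, from which every test is reached by adding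
    variables.\<close>
  have "u \<rightarrow>\<^sup>*\<^bsub>G\<^esub> v" if uv: "u \<in> verts G" "v \<in> verts G" for u v
  proof -
    obtain y z where yz: "u = test_of d y" "v = test_of d z" "z \<subseteq> {1..d}"
      using uv unfolding verts by (metis tests_cases)
    have "u \<rightarrow>\<^sup>*\<^bsub>G\<^esub> test_of d {}"
      unfolding yz by (intro reachable_adjI down) simp
    also have "test_of d {} \<rightarrow>\<^sup>*\<^bsub>G\<^esub> v"
      unfolding yz using yz(3) by (intro from_empty) (auto intro: finite_subset)
    finally show ?thesis .
  qed
  then have "strongly_connected G"
    using verts test_of_in_tests[of d "{}"] by (intro strongly_connectedI) auto
  then show ?thesis
    unfolding split_neighborly_def k_def[symmetric]
    using k by (intro bexI[of _ "1 / k"]) (auto simp: G_def)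
qed

end
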